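(* Let $q=x_0^2+x_1^2+x_2^2+x_3^2$ and $f_2+f_3=2(x_0^2+x_1^2)(x_2^2+x_3^2)$. No surface in the pencil of quartics in $\mathbb{P}_3(\mathbb{C})$ spanned by $q^2$ and $f_2+f_3$ contains isolated singularities. More precisely, $q^2-2(f_2+f_3)=q'^2$ with $q'=x_0^2+x_1^2-x_2^2-x_3^2$, so that each surface $q'^2+\lambda q^2=0$ ($\lambda\in\mathbb{C}$) of the pencil is a union of two quadrics $q'\pm \sqrt{-1}\sqrt{\lambda}\,q=0$; for $\lambda\neq0$ these meet in the four lines $\{x_0\pm \sqrt{-1}\,x_1=0,\ x_2\pm \sqrt{-1}\,x_3=0\}$ (all sign choices), which lie on $q=0$.
   Context: Here $f_2=2(x_0^2x_2^2+x_1^2x_3^2)$ and $f_3=2(x_0^2x_3^2+x_1^2x_2^2)$. The pencil is the pencil of degree-4 invariants of the groups $D_nD_m\subset SO(4)$ ($n,m\geq4$ even), i.e. the images of the products $\tilde D_n\times\tilde D_m$ of binary dihedral groups. An isolated singularity is a singular point having a neighbourhood containing no other singular point of the surface. *)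

theory Defs
  imports "HOL-Analysis.Analysis"
begin

definition proj_rel :: "complex ^ 4 \<Rightarrow> complex ^ 4 \<Rightarrow> bool" where
  "proj_rel v w \<longleftrightarrow> v \<noteq> 0 \<and> w \<noteq> 0 \<and> (\<exists>c. c \<noteq> 0 \<and> w = c *s v)"

lemma part_equivp_proj_rel: "part_equivp proj_rel"
proof (rule part_equivpI)
  have "proj_rel (axis 0 1) (axis 0 1)"
    unfolding proj_rel_def by (auto simp: axis_eq_0_iff intro!: exI[of _ 1])
  then show "\<exists>v. proj_rel v v" ..
next
  show "symp proj_rel"
  proof (rule sympI)
    fix v w assume "proj_rel v w"
    then obtain c where c: "v \<noteq> 0" "w \<noteq> 0" "c \<noteq> 0" "w = c *s v"
      unfolding proj_rel_def by blast
    then have "v = inverse c *s w" by (simp add: vector_smult_assoc)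
    with c show "proj_rel w v" unfolding proj_rel_def by (metis nonzero_imp_inverse_nonzero)
  qed
next
  show "transp proj_rel"
  proof (rule transpI)
    fix u v w assume "proj_rel u v" "proj_rel v w"
    then obtain c d where "u \<noteq> 0" "w \<noteq> 0" "c \<noteq> 0" "v = c *s u" "d \<noteq> 0" "w = d *s v"
      unfolding proj_rel_def by blast
    then show "proj_rel u w"
      unfolding proj_rel_def by (metis vector_smult_assoc mult_eq_0_iff)
  qed
qed

text \<open>Complex projective 3-space. The class \<open>proj v\<close> is meaningful only for \<open>v \<noteq> 0\<close>.\<close>

quotient_type cp3 = "complex ^ 4" / partial: proj_rel
  morphisms rep_cp3 proj
  by (rule part_equivp_proj_rel)

text \<open>The classical topology, i.e. the quotient topology of the nonzero vectors (an open subset).\<close>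

instantiation cp3 :: topological_space
begin

definition open_cp3 :: "cp3 set \<Rightarrow> bool" where
  "open_cp3 U \<longleftrightarrow> open {v. v \<noteq> 0 \<and> proj v \<in> U}"

instance
proof
  have "{v :: complex ^ 4. v \<noteq> 0 \<and> proj v \<in> UNIV} = - {0}" by auto
  then show "open (UNIV :: cp3 set)" unfolding open_cp3_def by (simp only: open_Compl closed_singleton)
next
  fix S T :: "cp3 set" assume "open S" "open T"
  moreover have "{v. v \<noteq> 0 \<and> proj v \<in> S \<inter> T} =
      {v. v \<noteq> 0 \<and> proj v \<in> S} \<inter> {v. v \<noteq> 0 \<and> proj v \<in> T}" by auto
  ultimately show "open (S \<inter> T)" unfolding open_cp3_def by auto
next
  fix K :: "cp3 set set" assume "\<forall>S\<in>K. open S"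
  moreover have "{v. v \<noteq> 0 \<and> proj v \<in> \<Union>K} = (\<Union>S\<in>K. {v. v \<noteq> 0 \<and> proj v \<in> S})" by auto
  ultimately show "open (\<Union>K)" unfolding open_cp3_def by auto
qed

end

text \<open>Forms in \<open>x\<^sub>0, \<dots>, x\<^sub>3\<close> are represented by the polynomial functions they induce on
  \<open>complex ^ 4\<close>, whose index type has the elements \<open>0, 1, 2, 3\<close>. A surface is given by its equation,
  so multiple components count as singular. For homogeneous \<open>F\<close> the conditions below do not
  depend on the chosen representative \<open>v\<close>.\<close>

definition zero_locus :: "(complex ^ 4 \<Rightarrow> complex) \<Rightarrow> cp3 set" where
  "zero_locus F = {proj v | v. v \<noteq> 0 \<and> F v = 0}"

definition partial_deriv :: "4 \<Rightarrow> (complex ^ 4 \<Rightarrow> complex) \<Rightarrow> complex ^ 4 \<Rightarrow> complex" where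
  "partial_deriv i F v = deriv (\<lambda>t. F (v + t *s axis i 1)) 0"

definition singular_locus :: "(complex ^ 4 \<Rightarrow> complex) \<Rightarrow> cp3 set" where
  "singular_locus F = {proj v | v. v \<noteq> 0 \<and> F v = 0 \<and> (\<forall>i. partial_deriv i F v = 0)}"

definition is_isolated_singularity :: "(complex ^ 4 \<Rightarrow> complex) \<Rightarrow> cp3 \<Rightarrow> bool" where
  "is_isolated_singularity F p \<longleftrightarrow>
     p \<in> singular_locus F \<and> (\<exists>U. open U \<and> p \<in> U \<and> U \<inter> singular_locus F = {p})"

definition pencil ::
  "(complex ^ 4 \<Rightarrow> complex) \<Rightarrow> (complex ^ 4 \<Rightarrow> complex) \<Rightarrow> (complex ^ 4 \<Rightarrow> complex) set" where
  "pencil F G = {(\<lambda>v. a * F v + b * G v) | a b. (a, b) \<noteq> (0, 0)}"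

definition is_quadratic_form :: "(complex ^ 4 \<Rightarrow> complex) \<Rightarrow> bool" where
  "is_quadratic_form F \<longleftrightarrow> (\<exists>c :: 4 \<Rightarrow> 4 \<Rightarrow> complex. \<forall>v. F v = (\<Sum>i\<in>UNIV. \<Sum>j\<in>UNIV. c i j * v $ i * v $ j))"

definition is_proj_line :: "cp3 set \<Rightarrow> bool" where
  "is_proj_line L \<longleftrightarrow> (\<exists>S. vec.subspace S \<and> vec.dim S = 2 \<and> L = proj ` (S - {0}))"

definition q :: "complex ^ 4 \<Rightarrow> complex" where
  "q x = (x $ 0)\<^sup>2 + (x $ 1)\<^sup>2 + (x $ 2)\<^sup>2 + (x $ 3)\<^sup>2"

definition q' :: "complex ^ 4 \<Rightarrow> complex" where
  "q' x = (x $ 0)\<^sup>2 + (x $ 1)\<^sup>2 - (x $ 2)\<^sup>2 - (x $ 3)\<^sup>2"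

definition f2 :: "complex ^ 4 \<Rightarrow> complex" where
  "f2 x = 2 * ((x $ 0)\<^sup>2 * (x $ 2)\<^sup>2 + (x $ 1)\<^sup>2 * (x $ 3)\<^sup>2)"

definition f3 :: "complex ^ 4 \<Rightarrow> complex" where
  "f3 x = 2 * ((x $ 0)\<^sup>2 * (x $ 3)\<^sup>2 + (x $ 1)\<^sup>2 * (x $ 2)\<^sup>2)"

definition base_line :: "complex \<Rightarrow> complex \<Rightarrow> cp3 set" where
  "base_line s t =
     {proj x | x. x \<noteq> 0 \<and> x $ 0 + s * \<i> * x $ 1 = 0 \<and> x $ 2 + t * \<i> * x $ 3 = 0}"

text \<open>The four lines \<open>x\<^sub>0 \<plusminus> \<i> x\<^sub>1 = 0, x\<^sub>2 \<plusminus> \<i> x\<^sub>3 = 0\<close>, with independent signs.\<close>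

definition base_lines :: "cp3 set set" where
  "base_lines = {base_line s t | s t. s \<in> {1, -1} \<and> t \<in> {1, -1}}"

end

theory Submission
  imports Defs
begin

text \<open>Put \<open>u = x\<^sub>0\<^sup>2 + x\<^sub>1\<^sup>2\<close> and \<open>w = x\<^sub>2\<^sup>2 + x\<^sub>3\<^sup>2\<close>. Every member of the pencil is a quadratic form in
  \<open>u\<close> and \<open>w\<close>, so its singular locus is invariant under rotating the planes \<open>(x\<^sub>0, x\<^sub>1)\<close> and
  \<open>(x\<^sub>2, x\<^sub>3)\<close>. A singular point with \<open>u \<noteq> 0\<close> or \<open>w \<noteq> 0\<close> is moved by such rotations, hence is not
  isolated. A point with \<open>u = w = 0\<close> lies on one of the four base lines, along which every member
  of the pencil is singular.\<close>

section \<open>Coordinates of vectors over the four-element index type\<close>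

lemma four_eq_0: "(4::4) = 0"
  by simp

text \<open>The standard expansions over this type run over 1, 2, 3, 4; since 4 = 0 here, they are
  restated for the indices 0 to 3 used in the definitions.\<close>

lemma forall_index_4: "(\<forall>i::4. P i) \<longleftrightarrow> P 0 \<and> P 1 \<and> P 2 \<and> P 3"
  using forall_4[of P] by (auto simp: four_eq_0)

lemma sum_index_4: "(\<Sum>i\<in>(UNIV::4 set). f i) = f 0 + f 1 + f 2 + f 3"
  by (simp add: sum_4 four_eq_0 add_ac)

lemma vec_eq_iff_4:
  "(v :: 'a ^ 4) = w \<longleftrightarrow> v $ 0 = w $ 0 \<and> v $ 1 = w $ 1 \<and> v $ 2 = w $ 2 \<and> v $ 3 = w $ 3"
  by (simp add: vec_eq_iff forall_index_4)

definition vec4 :: "'a \<Rightarrow> 'a \<Rightarrow> 'a \<Rightarrow> 'a \<Rightarrow> 'a ^ 4" where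
  "vec4 a b c d = (\<chi> i. if i = 0 then a else if i = 1 then b else if i = 2 then c else d)"

lemma vec4_nth [simp]:
  "vec4 a b c d $ 0 = a" "vec4 a b c d $ 1 = b" "vec4 a b c d $ 2 = c" "vec4 a b c d $ 3 = d"
  by (simp_all add: vec4_def)

lemma tendsto_vec4:
  fixes a b c d :: "'b \<Rightarrow> 'a :: real_normed_vector"
  assumes "(a \<longlongrightarrow> a') F" "(b \<longlongrightarrow> b') F" "(c \<longlongrightarrow> c') F" "(d \<longlongrightarrow> d') F"
  shows "((\<lambda>t. vec4 (a t) (b t) (c t) (d t)) \<longlongrightarrow> vec4 a' b' c' d') F"
proof -
  have "\<forall>i. ((\<lambda>t. vec4 (a t) (b t) (c t) (d t) $ i) \<longlongrightarrow> vec4 a' b' c' d' $ i) F"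
    unfolding forall_index_4 using assms by simp
  then show ?thesis by (intro vec_tendstoI) blast
qed

section \<open>Projective points, their representatives, and limits of singular points\<close>

lemma proj_rel_refl: "v \<noteq> 0 \<Longrightarrow> proj_rel v v"
  unfolding proj_rel_def by (auto intro!: exI[of _ 1])

text \<open>In a partial quotient, equality of classes amounts to the relation only where it is
  reflexive, that is, at nonzero vectors.\<close>

lemma proj_eq_iff:
  assumes "v \<noteq> 0" "w \<noteq> 0"
  shows "proj v = proj w \<longleftrightarrow> (\<exists>c. c \<noteq> 0 \<and> w = c *s v)"
  using Quotient3_rel[OF Quotient3_cp3, of v w] assms proj_rel_refl
  by (auto simp: proj_rel_def)

lemma proj_exhaust:
  obtains v where "v \<noteq> 0" "p = proj v"
  using Quotient3_abs_rep[OF Quotient3_cp3, of p] Quotient3_rel_rep[OF Quotient3_cp3, of p p]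
  by (metis proj_rel_def)

text \<open>Membership only supplies a zero of \<open>F\<close> at some representative; stability of
  zeros under scaling carries it to \<open>v\<close>.\<close>

lemma proj_in_zero_locus_iff:
  fixes v :: "complex ^ 4"
  assumes "v \<noteq> 0" and "\<And>c x. c \<noteq> 0 \<Longrightarrow> F x = 0 \<Longrightarrow> F (c *s x) = 0"
  shows "proj v \<in> zero_locus F \<longleftrightarrow> F v = 0"
proof
  assume "proj v \<in> zero_locus F"
  then obtain w where "w \<noteq> 0" "F w = 0" "proj w = proj v"
    unfolding zero_locus_def by auto
  then show "F v = 0"
    using proj_eq_iff[of w v] assms by auto
qed (use assms in \<open>auto simp: zero_locus_def\<close>)

text \<open>The nonzero vectors with class in a neighbourhood \<open>U\<close> of
  \<open>proj v\<close> form an open set around \<open>v\<close>, so the path lies in it for small t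
  > 0. There it represents a singular point of \<open>U\<close> other than
  \<open>proj v\<close>.\<close>

lemma not_isolated_singularityI:
  fixes \<gamma> :: "real \<Rightarrow> complex ^ 4"
  assumes "v \<noteq> 0" and lim: "(\<gamma> \<longlongrightarrow> v) (at_right 0)"
    and sing: "\<And>t. F (\<gamma> t) = 0" "\<And>t i. partial_deriv i F (\<gamma> t) = 0"
    and move: "\<forall>\<^sub>F t in at_right 0. \<forall>c. \<gamma> t \<noteq> c *s v"
  shows "\<not> is_isolated_singularity F (proj v)"
proof
  assume "is_isolated_singularity F (proj v)"
  then obtain U where U: "open U" "proj v \<in> U" "U \<inter> singular_locus F = {proj v}"
    unfolding is_isolated_singularity_def by blast
  have "open {x. x \<noteq> 0 \<and> proj x \<in> U}"
    using U(1) by (simp add: open_cp3_def)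
  then have "\<forall>\<^sub>F t in at_right 0. \<gamma> t \<in> {x. x \<noteq> 0 \<and> proj x \<in> U}"
    by (rule topological_tendstoD[OF lim]) (use \<open>v \<noteq> 0\<close> U(2) in simp)
  with move have "\<forall>\<^sub>F t in at_right 0. \<gamma> t \<noteq> 0 \<and> proj (\<gamma> t) \<in> U \<and> (\<forall>c. \<gamma> t \<noteq> c *s v)"
    by eventually_elim auto
  then obtain t where t: "\<gamma> t \<noteq> 0" "proj (\<gamma> t) \<in> U" "\<forall>c. \<gamma> t \<noteq> c *s v"
    using eventually_happens trivial_limit_at_right_real by blast
  then have "proj (\<gamma> t) \<in> singular_locus F"
    using sing unfolding singular_locus_def by auto
  then have "proj (\<gamma> t) \<in> {proj v}"
    unfolding U(3)[symmetric] using t(2) by (rule IntI[rotated])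
  then have "proj v = proj (\<gamma> t)" by simp
  then show False
    using t proj_eq_iff[OF \<open>v \<noteq> 0\<close>, of "\<gamma> t"] by auto
qed

section \<open>The pencil and its partial derivatives in terms of u = \<open>sq01\<close> and w =
  \<open>sq23\<close>\<close>

definition sq01 :: "complex ^ 4 \<Rightarrow> complex" where
  "sq01 x = (x $ 0)\<^sup>2 + (x $ 1)\<^sup>2"

definition sq23 :: "complex ^ 4 \<Rightarrow> complex" where
  "sq23 x = (x $ 2)\<^sup>2 + (x $ 3)\<^sup>2"

lemma q_eq: "q x = sq01 x + sq23 x" and q'_eq: "q' x = sq01 x - sq23 x"
  by (simp_all add: q_def q'_def sq01_def sq23_def)

lemma f2_plus_f3: "f2 x + f3 x = 2 * sq01 x * sq23 x"
  by (simp add: f2_def f3_def sq01_def sq23_def algebra_simps)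

lemma q_square_diff: "(q x)\<^sup>2 - 2 * (f2 x + f3 x) = (q' x)\<^sup>2"
  unfolding f2_plus_f3 q_eq q'_eq by (simp add: power2_eq_square algebra_simps)

text \<open>The increments are kept in the shape \<open>t * (2 * k + t)\<close>, so that one
  derivative computation serves all four variables.\<close>

lemma sq_plus_axis:
  "sq01 (v + t *s axis 0 1) = sq01 v + t * (2 * v $ 0 + t)"
  "sq01 (v + t *s axis 1 1) = sq01 v + t * (2 * v $ 1 + t)"
  "sq01 (v + t *s axis 2 1) = sq01 v" "sq01 (v + t *s axis 3 1) = sq01 v"
  "sq23 (v + t *s axis 0 1) = sq23 v" "sq23 (v + t *s axis 1 1) = sq23 v"
  "sq23 (v + t *s axis 2 1) = sq23 v + t * (2 * v $ 2 + t)"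
  "sq23 (v + t *s axis 3 1) = sq23 v + t * (2 * v $ 3 + t)"
  by (simp_all add: sq01_def sq23_def axis_def power2_eq_square algebra_simps)

text \<open>Chain rule: a(u+w)^2 + 2buw has u-derivative 2(a(u+w) + bw), and u has derivative 2
  \<open>v $ 0\<close> in the first variable; the others are alike. The two variables of a plane
  share a cofactor depending only on u and w.\<close>

lemma partial_deriv_pencil:
  fixes a b :: complex
  defines "F \<equiv> \<lambda>x. a * (q x)\<^sup>2 + b * (f2 x + f3 x)"
  shows "partial_deriv 0 F v = 4 * v $ 0 * (a * (sq01 v + sq23 v) + b * sq23 v)"
    and "partial_deriv 1 F v = 4 * v $ 1 * (a * (sq01 v + sq23 v) + b * sq23 v)"
    and "partial_deriv 2 F v = 4 * v $ 2 * (a * (sq01 v + sq23 v) + b * sq01 v)"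
    and "partial_deriv 3 F v = 4 * v $ 3 * (a * (sq01 v + sq23 v) + b * sq01 v)"
proof -
  have deriv: "deriv (\<lambda>t. a * (s + t * (2 * k + t) + r)\<^sup>2 + b * (2 * (s + t * (2 * k + t)) * r)) 0
      = 4 * k * (a * (s + r) + b * r)" for s k r
    by (rule DERIV_imp_deriv, (rule derivative_eq_intros refl)+, simp add: algebra_simps)
  \<comment> \<open>The form is symmetric in u and w; the swapped version lets \<open>deriv\<close>
    apply when w is the sum that varies.\<close>
  have F_eq: "F x = a * (sq01 x + sq23 x)\<^sup>2 + b * (2 * sq01 x * sq23 x)"
    and F_eq': "F x = a * (sq23 x + sq01 x)\<^sup>2 + b * (2 * sq23 x * sq01 x)" for x
    unfolding F_def f2_plus_f3 q_eq by (simp_all add: mult_ac add.commute)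
  show "partial_deriv 0 F v = 4 * v $ 0 * (a * (sq01 v + sq23 v) + b * sq23 v)"
    "partial_deriv 1 F v = 4 * v $ 1 * (a * (sq01 v + sq23 v) + b * sq23 v)"
    unfolding partial_deriv_def F_eq sq_plus_axis deriv by (rule refl)+
  show "partial_deriv 2 F v = 4 * v $ 2 * (a * (sq01 v + sq23 v) + b * sq01 v)"
    "partial_deriv 3 F v = 4 * v $ 3 * (a * (sq01 v + sq23 v) + b * sq01 v)"
    unfolding partial_deriv_def F_eq' sq_plus_axis deriv by (simp_all add: add.commute)
qed

section \<open>Absence of isolated singularities\<close>

lemma pencil_not_isolated:
  fixes a b :: complex
  defines "F \<equiv> \<lambda>x. a * (q x)\<^sup>2 + b * (f2 x + f3 x)"
  shows "\<not> is_isolated_singularity F p"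
proof
  assume isol: "is_isolated_singularity F p"
  then obtain v where v: "v \<noteq> 0" "p = proj v" "F v = 0" "\<forall>i. partial_deriv i F v = 0"
    unfolding is_isolated_singularity_def singular_locus_def by blast
  have F_eq: "F x = a * (sq01 x + sq23 x)\<^sup>2 + b * (2 * sq01 x * sq23 x)" for x
    unfolding F_def f2_plus_f3 q_eq ..
  note partials = partial_deriv_pencil[of a b, folded F_def]
  \<comment> \<open>Each case now only has to exhibit a path of singular vectors that tends to
    \<open>v\<close> and leaves the line spanned by \<open>v\<close>.\<close>
  have contra: False
    if "(\<gamma> \<longlongrightarrow> v) (at_right 0)" "\<And>t. F (\<gamma> t) = 0 \<and> (\<forall>i. partial_deriv i F (\<gamma> t) = 0)"
      "\<forall>\<^sub>F t in at_right 0. \<forall>c. \<gamma> t \<noteq> c *s v" for \<gamma> :: "real \<Rightarrow> complex ^ 4"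
    using not_isolated_singularityI[of v \<gamma> F] that v isol by blast
  show False
  proof (cases "sq01 v = 0 \<and> sq23 v = 0")
    case True
    \<comment> \<open>\<open>F\<close> is quadratic in u and w, and the cofactors in its partial
      derivatives are linear in them, all without constant term.\<close>
    have base: "F x = 0 \<and> (\<forall>i. partial_deriv i F x = 0)" if "sq01 x = 0" "sq23 x = 0" for x
      using that by (simp add: F_eq forall_index_4 partials)
    have root: "\<exists>e. (e = \<i> \<or> e = -\<i>) \<and> y = e * x" if "x\<^sup>2 + y\<^sup>2 = 0" for x y :: complex
    proof -
      have "(y - \<i> * x) * (y + \<i> * x) = 0"
        using that by (simp add: algebra_simps power2_eq_square)
      then have "y = \<i> * x \<or> y = -\<i> * x"
        by (simp add: eq_neg_iff_add_eq_0)
      then show ?thesis by blast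
    qed
    have pos: "\<forall>\<^sub>F t in at_right 0. (0::real) < t"
      by (simp add: eventually_at_right_less)
    show False
    proof (cases "v $ 0 = 0 \<and> v $ 1 = 0")
      case False
      obtain e where e: "e = \<i> \<or> e = -\<i>" "v $ 3 = e * v $ 2"
        using root[of "v $ 2" "v $ 3"] True by (auto simp: sq23_def)
      \<comment> \<open>The second pair moves along the direction (1, e) and equals
        (\<open>v $ 2\<close> + t)(1, e), so w stays 0 because e^2 = -1. The first pair is fixed and
        nonzero, so \<gamma> t = c v would force c = 1 and then t = 0.\<close>
      define \<gamma> where "\<gamma> t = vec4 (v $ 0) (v $ 1) (v $ 2 + of_real t) (v $ 3 + of_real t * e)" for t
      have e2: "e * e = -1" using e(1) by auto
      show False
      proof (rule contra)
        have "(\<gamma> \<longlongrightarrow> vec4 (v $ 0) (v $ 1) (v $ 2 + of_real 0) (v $ 3 + of_real 0 * e)) (at_right 0)"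
          unfolding \<gamma>_def by (intro tendsto_vec4 tendsto_intros)
        moreover have "vec4 (v $ 0) (v $ 1) (v $ 2 + of_real 0) (v $ 3 + of_real 0 * e) = v"
          by (simp add: vec_eq_iff_4)
        ultimately show "(\<gamma> \<longlongrightarrow> v) (at_right 0)" by simp
      next
        fix t
        have "sq01 (\<gamma> t) = 0" using True by (simp add: sq01_def \<gamma>_def)
        moreover have "sq23 (\<gamma> t) = (v $ 2 + of_real t)\<^sup>2 * (1 + e * e)"
          unfolding sq23_def by (simp add: \<gamma>_def e(2) power2_eq_square algebra_simps)
        ultimately show "F (\<gamma> t) = 0 \<and> (\<forall>i. partial_deriv i F (\<gamma> t) = 0)"
          using e2 by (intro base) simp_all
      next
        show "\<forall>\<^sub>F t in at_right 0. \<forall>c. \<gamma> t \<noteq> c *s v"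
          using pos
        proof eventually_elim
          fix t :: real assume t: "0 < t"
          show "\<forall>c. \<gamma> t \<noteq> c *s v"
            using False t by (auto simp: vec_eq_iff_4 \<gamma>_def)
        qed
      qed
    next
      case v01: True
      then have False: "\<not> (v $ 2 = 0 \<and> v $ 3 = 0)"
        using \<open>v \<noteq> 0\<close> by (auto simp: vec_eq_iff_4)
      \<comment> \<open>The first pair of \<open>v\<close> vanishes, so an isotropic direction has
        to be chosen: (1, \<i>). Multiples of \<open>v\<close> have first coordinate 0, while the
        path has t.\<close>
      define \<gamma> where "\<gamma> t = vec4 (of_real t) (of_real t * \<i>) (v $ 2) (v $ 3)" for t
      show False
      proof (rule contra)
        have "(\<gamma> \<longlongrightarrow> vec4 (of_real 0) (of_real 0 * \<i>) (v $ 2) (v $ 3)) (at_right 0)"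
          unfolding \<gamma>_def by (intro tendsto_vec4 tendsto_intros)
        moreover have "vec4 (of_real 0) (of_real 0 * \<i>) (v $ 2) (v $ 3) = v"
          using v01 by (simp add: vec_eq_iff_4)
        ultimately show "(\<gamma> \<longlongrightarrow> v) (at_right 0)" by simp
      next
        fix t
        show "F (\<gamma> t) = 0 \<and> (\<forall>i. partial_deriv i F (\<gamma> t) = 0)"
          using True by (intro base) (simp_all add: sq01_def sq23_def \<gamma>_def power_mult_distrib)
      next
        show "\<forall>\<^sub>F t in at_right 0. \<forall>c. \<gamma> t \<noteq> c *s v"
          using pos
        proof eventually_elim
          fix t :: real assume t: "0 < t"
          show "\<forall>c. \<gamma> t \<noteq> c *s v"
            using v01 t by (auto simp: vec_eq_iff_4 \<gamma>_def)
        qed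
      qed
    qed
  next
    case False
    define C S where "C t = complex_of_real (cos t)" and "S t = complex_of_real (sin t)" for t
    \<comment> \<open>Both planes are rotated by the same angle t, so one path covers u \<noteq> 0
      as well as w \<noteq> 0.\<close>
    define \<gamma> where "\<gamma> t = vec4 (C t * v $ 0 - S t * v $ 1) (S t * v $ 0 + C t * v $ 1)
      (C t * v $ 2 - S t * v $ 3) (S t * v $ 2 + C t * v $ 3)" for t
    have CS: "(C t)\<^sup>2 + (S t)\<^sup>2 = 1" for t
      unfolding C_def S_def by (metis of_real_1 of_real_add of_real_power sin_cos_squared_add2)
    show False
    proof (rule contra)
      have "(\<gamma> \<longlongrightarrow> vec4 (C 0 * v $ 0 - S 0 * v $ 1) (S 0 * v $ 0 + C 0 * v $ 1)
        (C 0 * v $ 2 - S 0 * v $ 3) (S 0 * v $ 2 + C 0 * v $ 3)) (at_right 0)"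
        unfolding \<gamma>_def C_def S_def by (intro tendsto_vec4 tendsto_intros)
      moreover have "vec4 (C 0 * v $ 0 - S 0 * v $ 1) (S 0 * v $ 0 + C 0 * v $ 1)
        (C 0 * v $ 2 - S 0 * v $ 3) (S 0 * v $ 2 + C 0 * v $ 3) = v"
        by (simp add: vec_eq_iff_4 C_def S_def)
      ultimately show "(\<gamma> \<longlongrightarrow> v) (at_right 0)" by simp
    next
      fix t
      have rot: "(C t * x - S t * y)\<^sup>2 + (S t * x + C t * y)\<^sup>2 = x\<^sup>2 + y\<^sup>2" for x y
      proof -
        have "(C t * x - S t * y)\<^sup>2 + (S t * x + C t * y)\<^sup>2
            = ((C t)\<^sup>2 + (S t)\<^sup>2) * (x\<^sup>2 + y\<^sup>2)"
          by (simp add: power2_eq_square algebra_simps)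
        then show ?thesis by (simp add: CS)
      qed
      have inv: "sq01 (\<gamma> t) = sq01 v" "sq23 (\<gamma> t) = sq23 v"
        unfolding sq01_def sq23_def by (simp_all add: \<gamma>_def rot)
      have "F (\<gamma> t) = 0"
        using v(3) by (simp add: F_eq inv)
      \<comment> \<open>The rotation mixes the two coordinates of a plane, but their partial
        derivatives share an invariant cofactor: either it is 0, or both coordinates are 0 and
        remain so.\<close>
      moreover have "\<forall>i. partial_deriv i F (\<gamma> t) = 0"
        using v(4) unfolding forall_index_4 partials inv by (auto simp: \<gamma>_def)
      ultimately show "F (\<gamma> t) = 0 \<and> (\<forall>i. partial_deriv i F (\<gamma> t) = 0)" ..
    next
      \<comment> \<open>On this interval the sine is positive, so the rotation has no real
        eigenvalue and its complex eigenvectors are isotropic.\<close>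
      have "\<forall>\<^sub>F t in at_right 0. t \<in> {0<..<pi}"
        by (rule eventually_at_right_real) simp
      then show "\<forall>\<^sub>F t in at_right 0. \<forall>c. \<gamma> t \<noteq> c *s v"
      proof eventually_elim
        fix t :: real assume "t \<in> {0<..<pi}"
        then have S: "S t \<noteq> 0"
          using sin_gt_zero[of t] unfolding S_def of_real_eq_0_iff by simp
        show "\<forall>c. \<gamma> t \<noteq> c *s v"
        proof (intro allI notI)
          fix c assume "\<gamma> t = c *s v"
          then have eqs: "C t * v $ 0 - S t * v $ 1 = c * v $ 0" "S t * v $ 0 + C t * v $ 1 = c * v $ 1"
            "C t * v $ 2 - S t * v $ 3 = c * v $ 2" "S t * v $ 2 + C t * v $ 3 = c * v $ 3"
            by (auto simp: vec_eq_iff_4 \<gamma>_def)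
          \<comment> \<open>Pairing a rotated vector \<open>(x, y)\<close> with \<open>(-y, x)\<close> leaves \<open>sin t * (x\<^sup>2 + y\<^sup>2)\<close>.\<close>
          have elim: "x\<^sup>2 + y\<^sup>2 = 0"
            if "C t * x - S t * y = c * x" "S t * x + C t * y = c * y" for x y
          proof -
            have "S t * (x\<^sup>2 + y\<^sup>2) = x * (S t * x + C t * y) - y * (C t * x - S t * y)"
              by (simp add: power2_eq_square algebra_simps)
            also have "\<dots> = 0" unfolding that by simp
            finally show ?thesis using S by simp
          qed
          show False
            using elim[OF eqs(1,2)] elim[OF eqs(3,4)] False by (simp add: sq01_def sq23_def)
        qed
      qed
    qed
  qed
qed

section \<open>Change of generators of the pencil, and the quadrics q' + m q\<close>

lemma pencil_eq:
  "pencil (\<lambda>x. (q x)\<^sup>2) (\<lambda>x. f2 x + f3 x) = pencil (\<lambda>x. (q' x)\<^sup>2) (\<lambda>x. (q x)\<^sup>2)"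
proof (intro equalityI subsetI)
  fix F assume "F \<in> pencil (\<lambda>x. (q x)\<^sup>2) (\<lambda>x. f2 x + f3 x)"
  then obtain a b where ab: "F = (\<lambda>x. a * (q x)\<^sup>2 + b * (f2 x + f3 x))" "(a, b) \<noteq> (0, 0)"
    unfolding pencil_def by blast
  \<comment> \<open>The coefficients come from f2 + f3 = (q^2 - q'^2)/2; the converse inclusion
    substitutes q'^2 = q^2 - 2(f2 + f3).\<close>
  have "F = (\<lambda>x. (- b / 2) * (q' x)\<^sup>2 + (a + b / 2) * (q x)\<^sup>2)"
    unfolding ab q_square_diff[symmetric] by (simp add: fun_eq_iff field_simps)
  moreover have "(- b / 2, a + b / 2) \<noteq> (0, 0)" using ab(2) by auto
  ultimately show "F \<in> pencil (\<lambda>x. (q' x)\<^sup>2) (\<lambda>x. (q x)\<^sup>2)"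
    unfolding pencil_def by blast
next
  fix F assume "F \<in> pencil (\<lambda>x. (q' x)\<^sup>2) (\<lambda>x. (q x)\<^sup>2)"
  then obtain a b where ab: "F = (\<lambda>x. a * (q' x)\<^sup>2 + b * (q x)\<^sup>2)" "(a, b) \<noteq> (0, 0)"
    unfolding pencil_def by blast
  have "F = (\<lambda>x. (a + b) * (q x)\<^sup>2 + (- 2 * a) * (f2 x + f3 x))"
    unfolding ab q_square_diff[symmetric] by (simp add: fun_eq_iff algebra_simps)
  moreover have "(a + b, - 2 * a) \<noteq> (0, 0)" using ab(2) by auto
  ultimately show "F \<in> pencil (\<lambda>x. (q x)\<^sup>2) (\<lambda>x. f2 x + f3 x)"
    unfolding pencil_def by blast
qed

text \<open>The coefficient matrix is diagonal with entries m+1, m+1, m-1, m-1. The factor with the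
  minus sign is covered by replacing m with -m.\<close>

lemma is_quadratic_form_q'_plus: "is_quadratic_form (\<lambda>x. q' x + m * q x)"
  unfolding is_quadratic_form_def
  by (rule exI[of _ "\<lambda>i j. if i \<noteq> j then 0 else if i = 0 \<or> i = 1 then m + 1 else m - 1"])
    (simp add: sum_index_4 q_def q'_def power2_eq_square algebra_simps)

text \<open>The values m+1 and m-1 at two unit vectors cannot both vanish, so each factor defines a
  genuine quadric.\<close>

lemma q'_plus_neq_0: "(\<lambda>x. q' x + m * q x) \<noteq> (\<lambda>x. 0)"
proof
  assume *: "(\<lambda>x. q' x + m * q x) = (\<lambda>x. 0)"
  show False
    using fun_cong[OF *, of "vec4 1 0 0 0"] fun_cong[OF *, of "vec4 0 0 1 0"]
    by (simp add: q_def q'_def)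
qed

lemma quadric_smult:
  "q (c *s x) = c\<^sup>2 * q x" "q' (c *s x) = c\<^sup>2 * q' x"
  by (simp_all add: q_def q'_def power_mult_distrib algebra_simps)

lemma proj_in_zero_locus_q'_plus:
  "v \<noteq> 0 \<Longrightarrow> proj v \<in> zero_locus (\<lambda>x. q' x + m * q x) \<longleftrightarrow> q' v + m * q v = 0"
proof (rule proj_in_zero_locus_iff)
  fix c :: complex and x assume "c \<noteq> 0" "q' x + m * q x = 0"
  moreover have "q' (c *s x) + m * q (c *s x) = c\<^sup>2 * (q' x + m * q x)"
    by (simp add: quadric_smult algebra_simps)
  ultimately show "q' (c *s x) + m * q (c *s x) = 0" by simp
qed

section \<open>The four base lines\<close>

lemma proj_in_base_line:
  assumes "v \<noteq> 0"
  shows "proj v \<in> base_line s t \<longleftrightarrow> v $ 0 + s * \<i> * v $ 1 = 0 \<and> v $ 2 + t * \<i> * v $ 3 = 0"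
proof
  assume "proj v \<in> base_line s t"
  then obtain w where w: "w \<noteq> 0" "proj w = proj v"
    "w $ 0 + s * \<i> * w $ 1 = 0" "w $ 2 + t * \<i> * w $ 3 = 0"
    unfolding base_line_def by auto
  then obtain c where c: "v = c *s w"
    using proj_eq_iff assms by blast
  have "v $ 0 + s * \<i> * v $ 1 = c * (w $ 0 + s * \<i> * w $ 1)"
    "v $ 2 + t * \<i> * v $ 3 = c * (w $ 2 + t * \<i> * w $ 3)"
    unfolding c by (simp_all add: algebra_simps)
  then show "v $ 0 + s * \<i> * v $ 1 = 0 \<and> v $ 2 + t * \<i> * v $ 3 = 0"
    using w by simp
qed (use assms in \<open>auto simp: base_line_def\<close>)

lemma sum_squares_eq_0_iff:
  fixes x y :: complex
  shows "x\<^sup>2 + y\<^sup>2 = 0 \<longleftrightarrow> (\<exists>s \<in> {1, -1}. x + s * \<i> * y = 0)"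
proof -
  have "x\<^sup>2 + y\<^sup>2 = (x + \<i> * y) * (x - \<i> * y)"
    by (simp add: power2_eq_square algebra_simps)
  then show ?thesis by simp
qed

text \<open>Each sign selects a linear factor of u or of w; as the signs are independent, the union
  splits into the two conditions.\<close>

lemma proj_in_Union_base_lines:
  assumes "v \<noteq> 0"
  shows "proj v \<in> \<Union> base_lines \<longleftrightarrow> sq01 v = 0 \<and> sq23 v = 0"
proof -
  have "proj v \<in> \<Union> base_lines \<longleftrightarrow> (\<exists>s \<in> {1, -1}. \<exists>t \<in> {1, -1}. proj v \<in> base_line s t)"
    unfolding base_lines_def by blast
  then show ?thesis
    unfolding sq01_def sq23_def sum_squares_eq_0_iff proj_in_base_line[OF assms]
    by (simp only: bex_simps)
qed

text \<open>Adding the two equations gives q' = 0, and then m \<noteq> 0 gives q = 0; since q and q'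
  are u + w and u - w, this means u = w = 0.\<close>

lemma zero_locus_Int:
  assumes "m \<noteq> 0"
  shows "zero_locus (\<lambda>x. q' x + m * q x) \<inter> zero_locus (\<lambda>x. q' x - m * q x) = \<Union> base_lines"
proof -
  have minus: "(\<lambda>x. q' x - m * q x) = (\<lambda>x. q' x + (- m) * q x)" by simp
  have "p \<in> zero_locus (\<lambda>x. q' x + m * q x) \<inter> zero_locus (\<lambda>x. q' x + (- m) * q x)
      \<longleftrightarrow> p \<in> \<Union> base_lines" for p
  proof -
    obtain v where v: "v \<noteq> 0" "p = proj v" by (rule proj_exhaust)
    have "q' v + m * q v = 0 \<and> q' v + (- m) * q v = 0 \<longleftrightarrow> q' v = 0 \<and> q v = 0"
    proof
      assume *: "q' v + m * q v = 0 \<and> q' v + (- m) * q v = 0"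
      have "2 * q' v = (q' v + m * q v) + (q' v + (- m) * q v)" by simp
      also have "\<dots> = 0" using * by (simp only: add_0_left)
      finally have "q' v = 0" by simp
      with * show "q' v = 0 \<and> q v = 0" using assms by simp
    qed simp
    also have "\<dots> \<longleftrightarrow> sq01 v = 0 \<and> sq23 v = 0"
    proof
      assume *: "q' v = 0 \<and> q v = 0"
      have "2 * sq01 v = q' v + q v" unfolding q_eq q'_eq by simp
      with * show "sq01 v = 0 \<and> sq23 v = 0" by (simp add: q_eq)
    qed (simp add: q_eq q'_eq)
    finally show ?thesis
      unfolding v(2) Int_iff proj_in_zero_locus_q'_plus[OF v(1)] proj_in_Union_base_lines[OF v(1)] .
  qed
  then show ?thesis unfolding minus by blast
qed

lemma base_line_inj:
  assumes "base_line s t = base_line s' t'"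
  shows "s = s' \<and> t = t'"
proof -
  \<comment> \<open>The point of the line with second and fourth coordinates 1; its other two
    coordinates reveal s and t.\<close>
  let ?v = "vec4 (- s * \<i>) 1 (- t * \<i>) 1"
  have v: "?v \<noteq> 0" by (simp add: vec_eq_iff_4)
  have "proj ?v \<in> base_line s t"
    unfolding proj_in_base_line[OF v] by simp
  then have "proj ?v \<in> base_line s' t'" using assms by simp
  then show ?thesis
    unfolding proj_in_base_line[OF v] by simp
qed

lemma card_base_lines: "card base_lines = 4"
proof -
  have "inj (case_prod base_line)"
  proof (rule injI)
    fix u v assume "case_prod base_line u = case_prod base_line v"
    then show "u = v"
      using base_line_inj[of "fst u" "snd u" "fst v" "snd v"]
      by (simp add: case_prod_unfold prod_eq_iff)
  qed
  then have "inj_on (case_prod base_line) ({1, -1} \<times> {1, -1})"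
    by (rule inj_on_subset) simp
  then have "card (case_prod base_line ` ({1, -1} \<times> {1, -1}))
      = card ({1, -1} \<times> {1, -1} :: (complex \<times> complex) set)"
    by (rule card_image)
  also have "\<dots> = 4"
    unfolding card_cartesian_product by simp
  also have "case_prod base_line ` ({1, -1} \<times> {1, -1}) = base_lines"
    unfolding base_lines_def by auto
  finally show ?thesis .
qed

lemma is_proj_line_base_line: "is_proj_line (base_line s t)"
proof -
  let ?S = "{x :: complex ^ 4. x $ 0 + s * \<i> * x $ 1 = 0 \<and> x $ 2 + t * \<i> * x $ 3 = 0}"
  \<comment> \<open>A basis of the solution space, with the second and fourth coordinates as free
    parameters.\<close>
  let ?a = "vec4 (- s * \<i>) 1 0 0" and ?b = "vec4 0 0 (- t * \<i>) 1"
  have neq: "?a \<noteq> ?b" by (simp add: vec_eq_iff_4)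
  have sub: "vec.subspace ?S"
    unfolding vec.subspace_def
  proof (intro conjI ballI allI)
    fix x y assume "x \<in> ?S" "y \<in> ?S"
    moreover have "(x + y) $ 0 + s * \<i> * (x + y) $ 1
        = (x $ 0 + s * \<i> * x $ 1) + (y $ 0 + s * \<i> * y $ 1)"
      "(x + y) $ 2 + t * \<i> * (x + y) $ 3
        = (x $ 2 + t * \<i> * x $ 3) + (y $ 2 + t * \<i> * y $ 3)"
      by (simp_all add: algebra_simps)
    ultimately show "x + y \<in> ?S" by simp
  next
    fix c x assume "x \<in> ?S"
    moreover have "(c *s x) $ 0 + s * \<i> * (c *s x) $ 1 = c * (x $ 0 + s * \<i> * x $ 1)"
      "(c *s x) $ 2 + t * \<i> * (c *s x) $ 3 = c * (x $ 2 + t * \<i> * x $ 3)"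
      by (simp_all add: algebra_simps)
    ultimately show "c *s x \<in> ?S" by simp
  qed simp
  have "?a \<notin> vec.span {?b}"
  proof
    assume "?a \<in> vec.span {?b}"
    then obtain k where "?a = k *s ?b"
      unfolding vec.span_singleton by blast
    from arg_cong[OF this, of "\<lambda>x. x $ 1"] show False by simp
  qed
  moreover have "?b \<noteq> 0" by (simp add: vec_eq_iff_4)
  ultimately have "vec.independent {?a, ?b}"
    using neq by (simp add: vec.independent_insert)
  moreover have "?S \<subseteq> vec.span {?a, ?b}"
  proof
    fix x assume "x \<in> ?S"
    then have "x $ 0 = - (s * \<i> * x $ 1)" "x $ 2 = - (t * \<i> * x $ 3)"
      by (simp_all add: eq_neg_iff_add_eq_0)
    then have "x = x $ 1 *s ?a + x $ 3 *s ?b"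
      by (simp add: vec_eq_iff_4)
    moreover have "x $ 1 *s ?a + x $ 3 *s ?b \<in> vec.span {?a, ?b}"
      by (intro vec.span_add vec.span_scale vec.span_base) simp_all
    ultimately show "x \<in> vec.span {?a, ?b}" by simp
  qed
  moreover have "{?a, ?b} \<subseteq> ?S" by auto
  ultimately have "vec.dim ?S = 2"
    using neq by (intro vec.dim_unique[of "{?a, ?b}"]) auto
  moreover have "base_line s t = proj ` (?S - {0})"
    unfolding base_line_def by auto
  ultimately show ?thesis
    unfolding is_proj_line_def using sub by blast
qed

lemma base_line_subset_zero_locus_q:
  assumes "L \<in> base_lines"
  shows "L \<subseteq> zero_locus q"
proof
  fix p assume "p \<in> L"
  obtain v where v: "v \<noteq> 0" "p = proj v" by (rule proj_exhaust)
  have "proj v \<in> \<Union> base_lines"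
    using assms \<open>p \<in> L\<close> unfolding v(2) by (rule UnionI)
  then have "q v = 0"
    unfolding proj_in_Union_base_lines[OF v(1)] q_eq by simp
  then show "p \<in> zero_locus q" using v by (auto simp: zero_locus_def)
qed

lemma zero_locus_mult: "zero_locus (\<lambda>x. F x * G x) = zero_locus F \<union> zero_locus G"
  unfolding zero_locus_def by auto

theorem mainTheorem12:
  shows "(\<forall>x. f2 x + f3 x = 2 * ((x $ 0)\<^sup>2 + (x $ 1)\<^sup>2) * ((x $ 2)\<^sup>2 + (x $ 3)\<^sup>2))
    \<and> (\<forall>F \<in> pencil (\<lambda>x. (q x)\<^sup>2) (\<lambda>x. f2 x + f3 x). \<not> (\<exists>p. is_isolated_singularity F p))
    \<and> (\<forall>x. (q x)\<^sup>2 - 2 * (f2 x + f3 x) = (q' x)\<^sup>2)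
    \<and> pencil (\<lambda>x. (q x)\<^sup>2) (\<lambda>x. f2 x + f3 x) = pencil (\<lambda>x. (q' x)\<^sup>2) (\<lambda>x. (q x)\<^sup>2)
    \<and> (\<forall>l :: complex.
         (\<lambda>x. (q' x)\<^sup>2 + l * (q x)\<^sup>2) \<in> pencil (\<lambda>x. (q x)\<^sup>2) (\<lambda>x. f2 x + f3 x)
       \<and> is_quadratic_form (\<lambda>x. q' x + \<i> * csqrt l * q x)
       \<and> (\<lambda>x. q' x + \<i> * csqrt l * q x) \<noteq> (\<lambda>x. 0)
       \<and> is_quadratic_form (\<lambda>x. q' x - \<i> * csqrt l * q x)
       \<and> (\<lambda>x. q' x - \<i> * csqrt l * q x) \<noteq> (\<lambda>x. 0)
       \<and> (\<forall>x. (q' x)\<^sup>2 + l * (q x)\<^sup>2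
                = (q' x + \<i> * csqrt l * q x) * (q' x - \<i> * csqrt l * q x))
       \<and> zero_locus (\<lambda>x. (q' x)\<^sup>2 + l * (q x)\<^sup>2)
           = zero_locus (\<lambda>x. q' x + \<i> * csqrt l * q x) \<union> zero_locus (\<lambda>x. q' x - \<i> * csqrt l * q x)
       \<and> (l \<noteq> 0 \<longrightarrow>
            zero_locus (\<lambda>x. q' x + \<i> * csqrt l * q x) \<inter> zero_locus (\<lambda>x. q' x - \<i> * csqrt l * q x)
              = \<Union> base_lines))
    \<and> card base_lines = 4
    \<and> (\<forall>L \<in> base_lines. is_proj_line L \<and> L \<subseteq> zero_locus q)"
proof (intro conjI allI ballI impI)
  fix x show "f2 x + f3 x = 2 * ((x $ 0)\<^sup>2 + (x $ 1)\<^sup>2) * ((x $ 2)\<^sup>2 + (x $ 3)\<^sup>2)"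
    by (simp add: f2_plus_f3 sq01_def sq23_def)
next
  fix F assume "F \<in> pencil (\<lambda>x. (q x)\<^sup>2) (\<lambda>x. f2 x + f3 x)"
  then show "\<not> (\<exists>p. is_isolated_singularity F p)"
    unfolding pencil_def using pencil_not_isolated by auto
next
  fix x show "(q x)\<^sup>2 - 2 * (f2 x + f3 x) = (q' x)\<^sup>2" by (rule q_square_diff)
next
  show "pencil (\<lambda>x. (q x)\<^sup>2) (\<lambda>x. f2 x + f3 x) = pencil (\<lambda>x. (q' x)\<^sup>2) (\<lambda>x. (q x)\<^sup>2)"
    by (rule pencil_eq)
next
  fix l :: complex
  \<comment> \<open>Since m^2 = -l, the member is the difference of squares q'^2 - m^2 q^2.\<close>
  define m where "m = \<i> * csqrt l"
  have minus: "(\<lambda>x. q' x - m * q x) = (\<lambda>x. q' x + (- m) * q x)" by simp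
  have m2: "m * m = - l"
  proof -
    have "m * m = - (csqrt l)\<^sup>2" by (simp add: m_def power2_eq_square algebra_simps)
    then show ?thesis by simp
  qed
  have prod: "(q' x)\<^sup>2 + l * (q x)\<^sup>2 = (q' x + m * q x) * (q' x - m * q x)" for x
  proof -
    have "(q' x + m * q x) * (q' x - m * q x) = (q' x)\<^sup>2 - (m * m) * (q x)\<^sup>2"
      by (simp add: power2_eq_square algebra_simps)
    then show ?thesis by (simp add: m2)
  qed
  show "(\<lambda>x. (q' x)\<^sup>2 + l * (q x)\<^sup>2) \<in> pencil (\<lambda>x. (q x)\<^sup>2) (\<lambda>x. f2 x + f3 x)"
    unfolding pencil_eq pencil_def by (rule CollectI, rule exI[of _ 1], rule exI[of _ l]) simp
  show "is_quadratic_form (\<lambda>x. q' x + \<i> * csqrt l * q x)" "(\<lambda>x. q' x + \<i> * csqrt l * q x) \<noteq> (\<lambda>x. 0)"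
    by (rule is_quadratic_form_q'_plus q'_plus_neq_0)+
  show "is_quadratic_form (\<lambda>x. q' x - \<i> * csqrt l * q x)" "(\<lambda>x. q' x - \<i> * csqrt l * q x) \<noteq> (\<lambda>x. 0)"
    unfolding m_def[symmetric] minus by (rule is_quadratic_form_q'_plus q'_plus_neq_0)+
  show "(q' x)\<^sup>2 + l * (q x)\<^sup>2 = (q' x + \<i> * csqrt l * q x) * (q' x - \<i> * csqrt l * q x)" for x
    unfolding m_def[symmetric] by (rule prod)
  show "zero_locus (\<lambda>x. (q' x)\<^sup>2 + l * (q x)\<^sup>2)
      = zero_locus (\<lambda>x. q' x + \<i> * csqrt l * q x) \<union> zero_locus (\<lambda>x. q' x - \<i> * csqrt l * q x)"
    unfolding m_def[symmetric] prod by (rule zero_locus_mult)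
  assume "l \<noteq> 0"
  then show "zero_locus (\<lambda>x. q' x + \<i> * csqrt l * q x) \<inter> zero_locus (\<lambda>x. q' x - \<i> * csqrt l * q x)
      = \<Union> base_lines"
    by (intro zero_locus_Int) simp
next
  show "card base_lines = 4" by (rule card_base_lines)
next
  fix L assume L: "L \<in> base_lines"
  then show "is_proj_line L"
    unfolding base_lines_def using is_proj_line_base_line by auto
  show "L \<subseteq> zero_locus q" using L by (rule base_line_subset_zero_locus_q)
qed

end
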